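(* (E$_6\to$F$_4$) Let $Q=(\triangle_{E_6},\xi)$ be a $\vee$-fixed Dynkin quiver of type $E_6$ and let $\overline Q=(\triangle_{F_4},\overline\xi)$ be the Dynkin quiver of type $F_4$ with $\overline\xi_{\bar\imath}=\xi_i$ for all $i$. Then for all $k\in\mathbb Z$ and all $i\in(\triangle_{E_6})_0$, $\psi\bigl(\tau_Q^k(\gamma_i^Q)\bigr)=\tau_{\overline Q}^k(\gamma_{\bar\imath}^{\overline Q})$. (D$_4\to$G$_2$) Let $Q=(\triangle_{D_4},\xi)$ be a $\widetilde\vee$-fixed Dynkin quiver of type $D_4$ and let $\overline Q=(\triangle_{G_2},\overline\xi)$ be the Dynkin quiver of type $G_2$ with $\overline\xi_{\bar\imath}=\xi_i$ for all $i$. Then for all $k\in\mathbb Z$ and all $i\in(\triangle_{D_4})_0$, $\widetilde\psi\bigl(\tau_Q^k(\gamma_i^Q)\bigr)=\tau_{\overline Q}^k(\gamma_{\bar\imath}^{\overline Q})$.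
   Context: For a finite Dynkin diagram $\triangle$ with vertex set $I$ and fundamental weights $\varpi_i$, a Dynkin quiver $Q=(\triangle,\xi)$ is given by a height function $\xi:I\to\mathbb Z$ with $|\xi_i-\xi_j|=1$ for adjacent $i,j$. $i$ is a source if $\xi_i>\xi_j$ for all neighbours $j$; then $s_iQ=(\triangle,s_i\xi)$, $(s_i\xi)_j=\xi_j-2\delta_{i,j}$. A reduced expression $s_{i_1}\cdots s_{i_l}$ in the Weyl group is $Q$-adapted if $i_k$ is a source of $s_{i_{k-1}}\cdots s_{i_1}Q$ for all $k$. $\tau_Q$ is the unique Coxeter element all of whose reduced expressions are $Q$-adapted; $\gamma_i^Q=(1-\tau_Q)\varpi_i\in\Phi^+$. For a diagram automorphism $\sigma$, $Q$ is $\sigma$-fixed if $\xi_{\sigma(i)}=\xi_i$ for all $i$. $E_6$: chain $1-3-4-5-6$ with $2$ attached to $4$; $\vee$ exchanges $1\leftrightarrow6$, $3\leftrightarrow5$ and fixes $2,4$. $F_4$: chain $1-2-3-4$ with $\alpha_1,\alpha_2$ long and $\alpha_3,\alpha_4$ short. The map $i\mapsto\bar\imath$ is $2\mapsto1$, $4\mapsto2$, $3,5\mapsto3$, $1,6\mapsto4$. $D_4$: central node $2$ with neighbours $1,3,4$; $\widetilde\vee:1\mapsto3\mapsto4\mapsto1$, $2\mapsto 2$. $G_2$: $\alpha_1$ short, $\alpha_2$ long. The map $i\mapsto\bar\imath$ is $2\mapsto2$ and $1,3,4\mapsto1$. $\psi$ (from the root lattice of $E_6$ to that of $F_4$) and $\widetilde\psi$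 (from that of $D_4$ to that of $G_2$) are the linear maps with $\alpha_i\mapsto\alpha_{\bar\imath}$; they map positive roots onto positive roots. *)

theory Defs
  imports "HOL-Analysis.Analysis"
begin

section \<open>Dynkin diagrams and their reflection representation\<close>

text \<open>
  A diagram is given by its vertices (a finite type), its edges (as two-element sets) and the
  numbers \<open>half_sqlen i = (\<alpha>\<^sub>i, \<alpha>\<^sub>i) / 2\<close>.  Multiplicity and direction of a bond are determined by the
  relative lengths of the two roots: for adjacent \<open>i\<close> and \<open>j\<close> one has
  \<open>(\<alpha>\<^sub>i, \<alpha>\<^sub>j) = - max (half_sqlen i) (half_sqlen j)\<close>.
\<close>

record 'v dynkin =
  edges :: "'v set set"
  half_sqlen :: "'v \<Rightarrow> int"

definition adjacent :: "'v dynkin \<Rightarrow> 'v \<Rightarrow> 'v \<Rightarrow> bool" where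
  "adjacent D i j \<longleftrightarrow> i \<noteq> j \<and> {i, j} \<in> edges D"

text \<open>\<open>cartan D i j = \<langle>h\<^sub>i, \<alpha>\<^sub>j\<rangle> = 2 (\<alpha>\<^sub>i, \<alpha>\<^sub>j) / (\<alpha>\<^sub>i, \<alpha>\<^sub>i)\<close>, so that \<open>s\<^sub>i \<alpha>\<^sub>j = \<alpha>\<^sub>j - cartan D i j \<alpha>\<^sub>i\<close>.\<close>

definition cartan :: "'v dynkin \<Rightarrow> 'v \<Rightarrow> 'v \<Rightarrow> int" where
  "cartan D i j =
     (if i = j then 2
      else if adjacent D i j then - (max (half_sqlen D i) (half_sqlen D j) div half_sqlen D i)
      else 0)"

text \<open>
  Vectors are elements of the real span of the root lattice, in coordinates with respect to the
  simple roots.  The root lattice is the set of vectors with integer coordinates, and since the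
  Cartan matrices considered are invertible, the weight lattice lies in the same space.
\<close>

abbreviation simple_root :: "'v::finite \<Rightarrow> real ^ 'v" where
  "simple_root i \<equiv> axis i 1"

definition coroot :: "'v::finite dynkin \<Rightarrow> 'v \<Rightarrow> real ^ 'v \<Rightarrow> real" where
  "coroot D i v = (\<Sum>j\<in>UNIV. of_int (cartan D i j) * v $ j)"

definition simple_reflection :: "'v::finite dynkin \<Rightarrow> 'v \<Rightarrow> real ^ 'v \<Rightarrow> real ^ 'v" where
  "simple_reflection D i v = v - coroot D i v *\<^sub>R simple_root i"

definition fundamental_weight :: "'v::finite dynkin \<Rightarrow> 'v \<Rightarrow> real ^ 'v" where
  "fundamental_weight D i = (THE w. \<forall>j. coroot D j w = (if j = i then 1 else 0))"

text \<open>The Weyl group element \<open>s\<^bsub>i\<^sub>1\<^esub> \<dots> s\<^bsub>i\<^sub>l\<^esub>\<close> expressed by a word \<open>[i\<^sub>1, \<dots>, i\<^sub>l]\<close>.\<close>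

definition word_element :: "'v::finite dynkin \<Rightarrow> 'v list \<Rightarrow> real ^ 'v \<Rightarrow> real ^ 'v" where
  "word_element D is = foldr (\<lambda>i w. simple_reflection D i \<circ> w) is id"

definition reduced_expression ::
  "'v::finite dynkin \<Rightarrow> 'v list \<Rightarrow> (real ^ 'v \<Rightarrow> real ^ 'v) \<Rightarrow> bool" where
  "reduced_expression D is w \<longleftrightarrow>
     word_element D is = w \<and> (\<forall>js. word_element D js = w \<longrightarrow> length is \<le> length js)"

definition coxeter_element :: "'v::finite dynkin \<Rightarrow> (real ^ 'v \<Rightarrow> real ^ 'v) \<Rightarrow> bool" where
  "coxeter_element D w \<longleftrightarrow> (\<exists>is. distinct is \<and> set is = UNIV \<and> w = word_element D is)"

text \<open>Integer powers of a bijection.\<close>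

definition int_power :: "('a \<Rightarrow> 'a) \<Rightarrow> int \<Rightarrow> 'a \<Rightarrow> 'a" where
  "int_power f k = (if k \<ge> 0 then f ^^ nat k else inv f ^^ nat (- k))"

section \<open>Dynkin quivers\<close>

text \<open>A Dynkin quiver is a pair of a diagram \<open>D\<close> and a height function \<open>\<xi>\<close> on it.\<close>

definition dynkin_quiver :: "'v dynkin \<Rightarrow> ('v \<Rightarrow> int) \<Rightarrow> bool" where
  "dynkin_quiver D \<xi> \<longleftrightarrow> (\<forall>i j. adjacent D i j \<longrightarrow> \<bar>\<xi> i - \<xi> j\<bar> = 1)"

definition source :: "'v dynkin \<Rightarrow> ('v \<Rightarrow> int) \<Rightarrow> 'v \<Rightarrow> bool" where
  "source D \<xi> i \<longleftrightarrow> (\<forall>j. adjacent D i j \<longrightarrow> \<xi> i > \<xi> j)"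

definition reflect_height :: "'v \<Rightarrow> ('v \<Rightarrow> int) \<Rightarrow> 'v \<Rightarrow> int" where
  "reflect_height i \<xi> = (\<lambda>j. \<xi> j - (if j = i then 2 else 0))"

primrec adapted :: "'v dynkin \<Rightarrow> ('v \<Rightarrow> int) \<Rightarrow> 'v list \<Rightarrow> bool" where
  "adapted D \<xi> [] \<longleftrightarrow> True"
| "adapted D \<xi> (i # is) \<longleftrightarrow> source D \<xi> i \<and> adapted D (reflect_height i \<xi>) is"

definition quiver_coxeter :: "'v::finite dynkin \<Rightarrow> ('v \<Rightarrow> int) \<Rightarrow> real ^ 'v \<Rightarrow> real ^ 'v" where
  "quiver_coxeter D \<xi> =
     (THE \<tau>. coxeter_element D \<tau> \<and> (\<forall>is. reduced_expression D is \<tau> \<longrightarrow> adapted D \<xi> is))"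

definition quiver_gamma :: "'v::finite dynkin \<Rightarrow> ('v \<Rightarrow> int) \<Rightarrow> 'v \<Rightarrow> real ^ 'v" where
  "quiver_gamma D \<xi> i = fundamental_weight D i - quiver_coxeter D \<xi> (fundamental_weight D i)"

definition fixed_by :: "('v \<Rightarrow> 'v) \<Rightarrow> ('v \<Rightarrow> int) \<Rightarrow> bool" where
  "fixed_by \<sigma> \<xi> \<longleftrightarrow> (\<forall>i. \<xi> (\<sigma> i) = \<xi> i)"

text \<open>The linear map sending \<open>\<alpha>\<^sub>i\<close> to \<open>\<alpha>\<^bsub>b i\<^esub>\<close>.\<close>

definition fold_roots :: "('v \<Rightarrow> 'w) \<Rightarrow> real ^ 'v::finite \<Rightarrow> real ^ 'w::finite" where
  "fold_roots b v = (\<Sum>i\<in>UNIV. v $ i *\<^sub>R simple_root (b i))"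

section \<open>The four diagrams and the two foldings\<close>

datatype e6 = E1 | E2 | E3 | E4 | E5 | E6
datatype f4 = F1 | F2 | F3 | F4
datatype d4 = D1 | D2 | D3 | D4
datatype g2 = G1 | G2

instance e6 :: finite
proof
  have "(UNIV :: e6 set) = {E1, E2, E3, E4, E5, E6}" using e6.exhaust by blast
  then show "finite (UNIV :: e6 set)" by (rule ssubst) simp
qed

instance f4 :: finite
proof
  have "(UNIV :: f4 set) = {F1, F2, F3, F4}" using f4.exhaust by blast
  then show "finite (UNIV :: f4 set)" by (rule ssubst) simp
qed

instance d4 :: finite
proof
  have "(UNIV :: d4 set) = {D1, D2, D3, D4}" using d4.exhaust by blast
  then show "finite (UNIV :: d4 set)" by (rule ssubst) simp
qed

instance g2 :: finite
proof
  have "(UNIV :: g2 set) = {G1, G2}" using g2.exhaust by blast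
  then show "finite (UNIV :: g2 set)" by (rule ssubst) simp
qed

definition dynkin_E6 :: "e6 dynkin" where
  "dynkin_E6 = \<lparr> edges = {{E1, E3}, {E3, E4}, {E4, E5}, {E5, E6}, {E2, E4}},
                 half_sqlen = (\<lambda>_. 1) \<rparr>"

definition dynkin_F4 :: "f4 dynkin" where
  "dynkin_F4 = \<lparr> edges = {{F1, F2}, {F2, F3}, {F3, F4}},
                 half_sqlen = (\<lambda>i. case i of F1 \<Rightarrow> 2 | F2 \<Rightarrow> 2 | F3 \<Rightarrow> 1 | F4 \<Rightarrow> 1) \<rparr>"

definition dynkin_D4 :: "d4 dynkin" where
  "dynkin_D4 = \<lparr> edges = {{D1, D2}, {D2, D3}, {D2, D4}}, half_sqlen = (\<lambda>_. 1) \<rparr>"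

definition dynkin_G2 :: "g2 dynkin" where
  "dynkin_G2 = \<lparr> edges = {{G1, G2}}, half_sqlen = (\<lambda>i. case i of G1 \<Rightarrow> 1 | G2 \<Rightarrow> 3) \<rparr>"

fun vee_E6 :: "e6 \<Rightarrow> e6" where
  "vee_E6 E1 = E6" | "vee_E6 E2 = E2" | "vee_E6 E3 = E5"
| "vee_E6 E4 = E4" | "vee_E6 E5 = E3" | "vee_E6 E6 = E1"

fun bar_E6 :: "e6 \<Rightarrow> f4" where
  "bar_E6 E1 = F4" | "bar_E6 E2 = F1" | "bar_E6 E3 = F3"
| "bar_E6 E4 = F2" | "bar_E6 E5 = F3" | "bar_E6 E6 = F4"

fun vee_D4 :: "d4 \<Rightarrow> d4" where
  "vee_D4 D1 = D3" | "vee_D4 D2 = D2" | "vee_D4 D3 = D4" | "vee_D4 D4 = D1"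

fun bar_D4 :: "d4 \<Rightarrow> g2" where
  "bar_D4 D1 = G1" | "bar_D4 D2 = G2" | "bar_D4 D3 = G1" | "bar_D4 D4 = G1"

text \<open>The folded height functions exist and are unique.\<close>

lemma folded_quiver_F4:
  assumes "dynkin_quiver dynkin_E6 \<xi>" and "fixed_by vee_E6 \<xi>"
  shows "\<exists>!\<xi>'. dynkin_quiver dynkin_F4 \<xi>' \<and> (\<forall>i. \<xi>' (bar_E6 i) = \<xi> i)"
proof -
  have fx: "\<xi> E6 = \<xi> E1" "\<xi> E5 = \<xi> E3"
    using assms(2) unfolding fixed_by_def by (metis vee_E6.simps)+
  have ad: "\<bar>\<xi> E1 - \<xi> E3\<bar> = 1" "\<bar>\<xi> E3 - \<xi> E4\<bar> = 1" "\<bar>\<xi> E2 - \<xi> E4\<bar> = 1"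
    using assms(1) by (simp_all add: dynkin_quiver_def adjacent_def dynkin_E6_def)
  show ?thesis
  proof (rule ex1I)
    let ?x = "\<lambda>j. case j of F1 \<Rightarrow> \<xi> E2 | F2 \<Rightarrow> \<xi> E4 | F3 \<Rightarrow> \<xi> E3 | F4 \<Rightarrow> \<xi> E1"
    have "?x (bar_E6 i) = \<xi> i" for i by (cases i) (simp_all add: fx)
    moreover have "dynkin_quiver dynkin_F4 ?x"
      using ad by (auto simp: dynkin_quiver_def adjacent_def dynkin_F4_def doubleton_eq_iff
                        split: f4.splits)
    ultimately show "dynkin_quiver dynkin_F4 ?x \<and> (\<forall>i. ?x (bar_E6 i) = \<xi> i)" by blast
    fix y assume "dynkin_quiver dynkin_F4 y \<and> (\<forall>i. y (bar_E6 i) = \<xi> i)"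
    then have *: "y (bar_E6 i) = \<xi> i" for i by blast
    show "y = ?x"
    proof
      fix j show "y j = ?x j"
        using *[of E1] *[of E2] *[of E3] *[of E4] by (cases j) simp_all
    qed
  qed
qed

lemma folded_quiver_G2:
  assumes "dynkin_quiver dynkin_D4 \<xi>" and "fixed_by vee_D4 \<xi>"
  shows "\<exists>!\<xi>'. dynkin_quiver dynkin_G2 \<xi>' \<and> (\<forall>i. \<xi>' (bar_D4 i) = \<xi> i)"
proof -
  have fx: "\<xi> D3 = \<xi> D1" "\<xi> D4 = \<xi> D1"
    using assms(2) unfolding fixed_by_def by (metis vee_D4.simps)+
  have ad: "\<bar>\<xi> D1 - \<xi> D2\<bar> = 1"
    using assms(1) by (simp add: dynkin_quiver_def adjacent_def dynkin_D4_def)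
  show ?thesis
  proof (rule ex1I)
    let ?x = "\<lambda>j. case j of G1 \<Rightarrow> \<xi> D1 | G2 \<Rightarrow> \<xi> D2"
    have "?x (bar_D4 i) = \<xi> i" for i by (cases i) (simp_all add: fx)
    moreover have "dynkin_quiver dynkin_G2 ?x"
      using ad by (auto simp: dynkin_quiver_def adjacent_def dynkin_G2_def doubleton_eq_iff
                        split: g2.splits)
    ultimately show "dynkin_quiver dynkin_G2 ?x \<and> (\<forall>i. ?x (bar_D4 i) = \<xi> i)" by blast
    fix y assume "dynkin_quiver dynkin_G2 y \<and> (\<forall>i. y (bar_D4 i) = \<xi> i)"
    then have *: "y (bar_D4 i) = \<xi> i" for i by blast
    show "y = ?x"
    proof
      fix j show "y j = ?x j"
        using *[of D1] *[of D2] by (cases j) simp_all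
    qed
  qed
qed

end

theory Submission
  imports Defs
begin

text \<open>
  Reading off one coordinate at a time, the product \<open>\<tau>\<close> of a \<open>Q\<close>-adapted word containing every
  letter once is described by a linear system: \<open>\<tau> v = x\<close> if and only if for every vertex \<open>i\<close>
  \<open>x\<^sub>i + v\<^sub>i + \<langle>h\<^sub>i, z\<rangle> = 0\<close>, where \<open>z\<close> agrees with \<open>x\<close> below the height \<open>\<xi>\<^sub>i\<close> and with \<open>v\<close> above it.
  The system depends on \<open>\<xi>\<close> only, which gives the uniqueness of \<open>\<tau>\<^sub>Q\<close>; and it is compatible with
  summation over the fibres of the folding, because the Cartan integers satisfy
  \<open>\<Sum>\<^bsub>b i = p\<^esub> \<langle>h\<^sub>i, \<alpha>\<^sub>j\<rangle> = \<langle>h\<^sub>p, \<alpha>\<^bsub>b j\<^esub>\<rangle>\<close>.  Hence folding intertwines \<open>\<tau>\<^sub>Q\<close> with the Coxeter element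
  of the folded quiver, and for the same reason it maps fundamental weights to fundamental weights.
\<close>

section \<open>Words in simple reflections\<close>

lemma linear_coroot: "linear (coroot D i)"
  by (rule linearI) (simp_all add: coroot_def algebra_simps sum.distrib sum_distrib_left)

lemma coroot_simple_root: "coroot D i (simple_root j) = of_int (cartan D i j)"
proof -
  have "coroot D i (simple_root j) = (\<Sum>k\<in>UNIV. if k = j then of_int (cartan D i j) else 0)"
    unfolding coroot_def by (intro sum.cong) (auto simp: axis_def)
  then show ?thesis by simp
qed

lemma coroot_cong:
  assumes "\<And>j. cartan D i j \<noteq> 0 \<Longrightarrow> u $ j = v $ j"
  shows "coroot D i u = coroot D i v"
  unfolding coroot_def by (intro sum.cong) (use assms in auto)

lemma cartan_eq_0: "i \<noteq> j \<Longrightarrow> \<not> adjacent D i j \<Longrightarrow> cartan D i j = 0"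
  by (simp add: cartan_def)

lemma cartan_diag [simp]: "cartan D i i = 2"
  by (simp add: cartan_def)

lemma linear_simple_reflection: "linear (simple_reflection D i)"
proof -
  interpret c: linear "coroot D i" by (rule linear_coroot)
  show ?thesis
    by (rule linearI) (simp_all add: simple_reflection_def c.add c.scale algebra_simps)
qed

lemma simple_reflection_nth:
  "simple_reflection D i v $ j = (if j = i then v $ i - coroot D i v else v $ j)"
  by (simp add: simple_reflection_def axis_def)

lemma simple_reflection_involution: "simple_reflection D i (simple_reflection D i v) = v"
proof -
  interpret c: linear "coroot D i" by (rule linear_coroot)
  show ?thesis
    by (simp add: simple_reflection_def c.diff c.scale coroot_simple_root)
qed

lemma word_element_Nil [simp]: "word_element D [] v = v"
  by (simp add: word_element_def)

lemma word_element_Cons [simp]: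
  "word_element D (i # is) v = simple_reflection D i (word_element D is v)"
  by (simp add: word_element_def)

lemma linear_word_element: "linear (word_element D is)"
proof (induction "is")
  case Nil
  then show ?case using linear_id by (simp add: word_element_def id_def)
next
  case (Cons i "is")
  then show ?case
    using linear_compose[OF Cons linear_simple_reflection[of D i]]
    by (simp add: word_element_def o_def)
qed

lemma bij_word_element: "bij (word_element D is)"
proof (induction "is")
  case Nil
  then show ?case using bij_id by (simp add: word_element_def id_def)
next
  case (Cons i "is")
  have "bij (simple_reflection D i)"
    by (rule o_bij[of "simple_reflection D i"]) (auto simp: simple_reflection_involution)
  then show ?case
    using bij_comp[OF Cons] by (simp add: word_element_def o_def)
qed

section \<open>Coordinates of a product of reflections\<close>

lemma split_list_UNIV:
  assumes "set xs = UNIV"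
  shows "\<exists>us ws. xs = us @ i # ws"
  by (rule split_list) (simp add: assms)

lemma word_element_append_nth:
  "i \<notin> set us \<Longrightarrow> word_element D (us @ ws) v $ i = word_element D ws v $ i"
  by (induction us) (auto simp: simple_reflection_nth)

lemma word_element_nth_notin: "i \<notin> set ws \<Longrightarrow> word_element D ws v $ i = v $ i"
  using word_element_append_nth[of i ws D "[]"] by simp

lemma word_element_nth:
  assumes "i \<notin> set us"
  shows "word_element D (us @ i # ws) v $ i =
           word_element D ws v $ i - coroot D i (word_element D ws v)"
  using assms by (simp add: word_element_append_nth simple_reflection_nth)

text \<open>Each letter changes only its own coordinate, and only once. When \<open>i\<close> acts,
  the letters of \<open>ws\<close> have acted already, so their coordinates are final, and all
  others are still those of \<open>v\<close>.\<close>

lemma word_element_distinct_nth: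
  assumes "distinct (us @ i # ws)" and "x = word_element D (us @ i # ws) v"
  shows "x $ i = v $ i - coroot D i (\<chi> j. if j \<in> set ws then x $ j else v $ j)"
proof -
  have "word_element D ws v $ j = (if j \<in> set ws then x $ j else v $ j)" for j
  proof (cases "j \<in> set ws")
    case True
    then have "j \<notin> set (us @ [i])" using assms(1) by auto
    from word_element_append_nth[OF this, of D ws v] show ?thesis
      using True assms(2) by simp
  qed (simp add: word_element_nth_notin)
  then have "word_element D ws v = (\<chi> j. if j \<in> set ws then x $ j else v $ j)"
    by (simp add: vec_eq_iff)
  moreover have "word_element D ws v $ i = v $ i"
    using assms by (simp add: word_element_nth_notin)
  ultimately show ?thesis
    using assms word_element_nth[of i us D ws v] by simp
qed

text \<open>
  A word without the letter \<open>i\<close> does not change the \<open>i\<close>-th coordinate, but a Coxeter element does.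
\<close>

lemma coxeter_word_support:
  assumes "distinct is" and "set is = UNIV" and "word_element D js = word_element D is"
  shows "set js = UNIV"
proof (rule ccontr)
  assume "set js \<noteq> UNIV"
  then obtain i where i: "i \<notin> set js" by blast
  obtain us ws where dec: "is = us @ i # ws"
    using split_list_UNIV[OF assms(2)] by blast
  \<comment> \<open>With this \<open>v\<close> the letter \<open>i\<close> meets its own simple root
    and negates it.\<close>
  obtain v where v: "word_element D ws v = simple_root i"
    using bij_is_surj[OF bij_word_element[of D ws]] by (metis surjD)
  have "v $ i = 1"
    using word_element_nth_notin[of i ws D v] assms(1) v by (simp add: dec)
  moreover have "word_element D is v $ i = -1"
    using word_element_nth[of i us D ws v] assms(1) v
    by (simp add: dec coroot_simple_root)
  moreover have "word_element D js v $ i = v $ i"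
    using i by (rule word_element_nth_notin)
  ultimately show False using assms(3) by simp
qed

section \<open>Adapted words\<close>

text \<open>Exposes the suffix behind each letter, the data on which
  \<open>word_element_distinct_nth\<close> depends.\<close>

lemma sorted_wrt_iff_split:
  "sorted_wrt P xs \<longleftrightarrow> (\<forall>us x ws. xs = us @ x # ws \<longrightarrow> (\<forall>y\<in>set ws. P x y))"
proof
  show "sorted_wrt P xs \<Longrightarrow> \<forall>us x ws. xs = us @ x # ws \<longrightarrow> (\<forall>y\<in>set ws. P x y)"
    by (auto simp: sorted_wrt_append)
  show "\<forall>us x ws. xs = us @ x # ws \<longrightarrow> (\<forall>y\<in>set ws. P x y) \<Longrightarrow> sorted_wrt P xs"
  proof (induction xs)
    case (Cons a xs)
    have "\<forall>y\<in>set xs. P a y" using Cons.prems[rule_format, of "[]" a xs] by simp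
    moreover have "sorted_wrt P xs"
    proof (intro Cons.IH allI impI)
      fix us x ws assume "xs = us @ x # ws"
      then show "\<forall>y\<in>set ws. P x y"
        using Cons.prems[rule_format, of "a # us" x ws] by simp
    qed
    ultimately show ?case by simp
  qed simp
qed

text \<open>Static counterpart of \<open>adapted\<close>: the height function stays fixed instead of
  being reflected after every letter.\<close>

definition downhill :: "'v dynkin \<Rightarrow> ('v \<Rightarrow> int) \<Rightarrow> 'v list \<Rightarrow> bool" where
  "downhill D \<xi> = sorted_wrt (\<lambda>i j. adjacent D i j \<longrightarrow> \<xi> j < \<xi> i)"

lemma adjacent_sym: "adjacent D i j \<longleftrightarrow> adjacent D j i"
  by (auto simp: adjacent_def insert_commute)

lemma dynkin_quiver_adjacent: "dynkin_quiver D \<xi> \<Longrightarrow> adjacent D i j \<Longrightarrow> \<bar>\<xi> i - \<xi> j\<bar> = 1"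
  by (simp add: dynkin_quiver_def)

lemma adapted_iff_downhill_aux:
  assumes Q: "dynkin_quiver D \<xi>"
  shows "distinct (us @ is) \<Longrightarrow> set (us @ is) = UNIV \<Longrightarrow>
    adapted D (\<lambda>j. \<xi> j - (if j \<in> set us then 2 else 0)) is \<longleftrightarrow> downhill D \<xi> is"
proof (induction "is" arbitrary: us)
  case Nil
  then show ?case by (simp add: downhill_def)
next
  case (Cons i "is")
  let ?\<eta> = "\<lambda>us j. \<xi> j - (if j \<in> set us then 2 else 0)"
  have i: "i \<notin> set us" using Cons.prems by simp
  have "reflect_height i (?\<eta> us) = ?\<eta> (us @ [i])"
    using i by (auto simp: reflect_height_def fun_eq_iff)
  moreover have "adapted D (?\<eta> (us @ [i])) is \<longleftrightarrow> downhill D \<xi> is"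
    using Cons.prems by (intro Cons.IH) auto
  moreover have "source D (?\<eta> us) i \<longleftrightarrow> (\<forall>j\<in>set is. adjacent D i j \<longrightarrow> \<xi> j < \<xi> i)"
  proof -
    have "?\<eta> us j < ?\<eta> us i \<longleftrightarrow> (j \<in> set is \<longrightarrow> \<xi> j < \<xi> i)" if "adjacent D i j" for j
    proof -
      have "j \<noteq> i" using that by (auto simp: adjacent_def)
      then have "j \<in> set us \<longleftrightarrow> j \<notin> set is" using Cons.prems by auto
      then show ?thesis using dynkin_quiver_adjacent[OF Q that] i by auto
    qed
    then show ?thesis unfolding source_def by blast
  qed
  ultimately show ?case by (simp add: downhill_def)
qed

lemma adapted_iff_downhill:
  assumes "dynkin_quiver D \<xi>" "distinct is" "set is = UNIV"
  shows "adapted D \<xi> is \<longleftrightarrow> downhill D \<xi> is"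
  using adapted_iff_downhill_aux[of D \<xi> "[]" "is"] assms by simp

lemma downhill_word_exists:
  fixes D :: "'v::finite dynkin"
  assumes "dynkin_quiver D \<xi>"
  obtains "is" where "distinct is" "set is = UNIV" "downhill D \<xi> is"
proof -
  obtain xs :: "'v list" where xs: "set xs = UNIV" "distinct xs"
    using finite_distinct_list[of "UNIV :: 'v set"] by auto
  \<comment> \<open>Sorting by decreasing height suffices because neighbours never tie.\<close>
  let ?is = "sort_key (\<lambda>i. - \<xi> i) xs"
  have "sorted_wrt (\<lambda>i j. - \<xi> i \<le> - \<xi> j) ?is"
    using sorted_sort_key[of "\<lambda>i. - \<xi> i" xs] by (simp add: sorted_wrt_map)
  then have "downhill D \<xi> ?is"
    unfolding downhill_def
    by (rule sorted_wrt_mono_rel[rotated]) (use dynkin_quiver_adjacent[OF assms] in fastforce)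
  then show ?thesis using that[of ?is] xs by simp
qed

section \<open>The linear system for the Coxeter element\<close>

definition interpolate :: "('v \<Rightarrow> int) \<Rightarrow> int \<Rightarrow> real ^ 'v \<Rightarrow> real ^ 'v \<Rightarrow> real ^ 'v::finite" where
  "interpolate \<xi> t x v = (\<chi> j. if \<xi> j < t then x $ j else if t < \<xi> j then v $ j else 0)"

text \<open>In a Dynkin quiver no neighbour of \<open>i\<close> has height \<open>\<xi> i\<close>,
  so the value 0 there affects only \<open>i\<close> itself, whose share \<open>2 * v $ i\<close> is
  absorbed into the term \<open>v $ i\<close>.\<close>

definition coxeter_system ::
  "'v::finite dynkin \<Rightarrow> ('v \<Rightarrow> int) \<Rightarrow> real ^ 'v \<Rightarrow> real ^ 'v \<Rightarrow> bool" where
  "coxeter_system D \<xi> v x \<longleftrightarrow>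
     (\<forall>i. x $ i + v $ i + coroot D i (interpolate \<xi> (\<xi> i) x v) = 0)"

text \<open>In a downhill word the neighbours to the right of \<open>i\<close> are exactly the lower
  ones, so the word's mixture of old and new coordinates can be read off from heights.\<close>

lemma coxeter_system_word:
  assumes Q: "dynkin_quiver D \<xi>" and "is": "distinct is" "set is = UNIV" "downhill D \<xi> is"
  shows "coxeter_system D \<xi> v (word_element D is v)"
  unfolding coxeter_system_def
proof
  fix i
  define x where "x = word_element D is v"
  interpret c: linear "coroot D i" by (rule linear_coroot)
  obtain us ws where dec: "is = us @ i # ws"
    using split_list_UNIV[OF "is"(2)] by blast
  have after: "j \<in> set ws \<longleftrightarrow> \<xi> j < \<xi> i" if "adjacent D i j" for j
  proof -
    have "j \<noteq> i" using that by (auto simp: adjacent_def)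
    moreover have "j \<in> set (us @ i # ws)" using "is"(2) dec by simp
    ultimately show ?thesis
      using "is"(1,3) that adjacent_sym[of D i j]
      unfolding dec downhill_def by (fastforce simp: sorted_wrt_append)
  qed
  have "coroot D i (\<chi> j. if j \<in> set ws then x $ j else v $ j) =
        coroot D i (v $ i *\<^sub>R simple_root i + interpolate \<xi> (\<xi> i) x v)"
  proof (rule coroot_cong)
    fix j assume "cartan D i j \<noteq> 0"
    then consider "j = i" | "j \<noteq> i" "adjacent D i j" using cartan_eq_0 by metis
    then show "(\<chi> j. if j \<in> set ws then x $ j else v $ j) $ j =
        (v $ i *\<^sub>R simple_root i + interpolate \<xi> (\<xi> i) x v) $ j"
    proof cases
      case 1
      then show ?thesis using "is"(1) dec by (simp add: interpolate_def axis_def)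
    next
      case 2
      then show ?thesis
        using after[of j] dynkin_quiver_adjacent[OF Q, of i j]
        by (auto simp: interpolate_def axis_def)
    qed
  qed
  also have "\<dots> = 2 * v $ i + coroot D i (interpolate \<xi> (\<xi> i) x v)"
    by (simp add: c.add c.scale coroot_simple_root)
  finally show "word_element D is v $ i + v $ i +
      coroot D i (interpolate \<xi> (\<xi> i) (word_element D is v) v) = 0"
    using word_element_distinct_nth[of us i ws x D v] "is"(1) dec x_def by simp
qed

text \<open>The system is triangular: the equation at \<open>i\<close> involves \<open>x\<close>
  only at \<open>i\<close> and at lower vertices. A lowest disagreement is therefore
  impossible.\<close>

lemma coxeter_system_unique:
  assumes "coxeter_system D \<xi> v x" "coxeter_system D \<xi> v y"
  shows "x = y"
proof (rule ccontr)
  assume "x \<noteq> y"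
  then have "{i. x $ i \<noteq> y $ i} \<noteq> {}" by (simp add: vec_eq_iff)
  then obtain i where i: "is_arg_min \<xi> (\<lambda>i. i \<in> {i. x $ i \<noteq> y $ i}) i"
    using ex_is_arg_min_if_finite[of "{i. x $ i \<noteq> y $ i}" \<xi>] by auto
  then have "x $ j = y $ j" if "\<xi> j < \<xi> i" for j
    using that by (auto simp: is_arg_min_def)
  then have "interpolate \<xi> (\<xi> i) x v = interpolate \<xi> (\<xi> i) y v"
    by (simp add: interpolate_def vec_eq_iff)
  moreover have "x $ i + v $ i + coroot D i (interpolate \<xi> (\<xi> i) x v) = 0"
    and "y $ i + v $ i + coroot D i (interpolate \<xi> (\<xi> i) y v) = 0"
    using assms unfolding coxeter_system_def by blast+
  ultimately have "x $ i = y $ i" by simp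
  then show False using i by (simp add: is_arg_min_def)
qed

section \<open>Diagrams with invertible Cartan matrix\<close>

text \<open>Positive lengths keep the integer division in \<open>cartan\<close> from giving 0 on
  edges; nondegeneracy provides the fundamental weights and excludes 1 as an eigenvalue of Coxeter
  elements.\<close>

locale nondegenerate_diagram =
  fixes D :: "'v::finite dynkin"
  assumes half_sqlen_pos: "half_sqlen D i > 0"
    and nondegenerate: "(\<And>i. coroot D i v = 0) \<Longrightarrow> v = 0"
begin

lemma cartan_adjacent: "adjacent D i j \<Longrightarrow> cartan D i j \<noteq> 0"
proof -
  assume "adjacent D i j"
  moreover have "max (half_sqlen D i) (half_sqlen D j) div half_sqlen D i > 0"
    using half_sqlen_pos[of i] by (simp add: pos_imp_zdiv_pos_iff)
  ultimately show ?thesis by (auto simp: cartan_def adjacent_def)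
qed

lemma coroot_inject:
  assumes "\<And>i. coroot D i v = coroot D i w"
  shows "v = w"
proof -
  have "coroot D i (v - w) = 0" for i
    using linear_diff[OF linear_coroot[of D i], of v w] assms by simp
  then show ?thesis using nondegenerate[of "v - w"] by simp
qed

lemma coroot_fundamental_weight:
  "coroot D j (fundamental_weight D i) = (if j = i then 1 else 0)"
proof -
  let ?f = "\<lambda>v. \<chi> j. coroot D j v"
  have "linear ?f"
    by (rule linearI)
       (simp_all add: vec_eq_iff linear_add[OF linear_coroot] linear_scale[OF linear_coroot])
  moreover have "inj ?f"
    by (rule injI, rule coroot_inject) (simp add: vec_eq_iff)
  ultimately have "surj ?f" by (rule linear_inj_imp_surj)
  then obtain w where "?f w = simple_root i" by (metis surjD)
  then have w: "\<forall>j. coroot D j w = (if j = i then 1 else 0)"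
    by (simp add: vec_eq_iff axis_def)
  have "\<forall>j. coroot D j (fundamental_weight D i) = (if j = i then 1 else 0)"
    unfolding fundamental_weight_def
    by (rule theI[of _ w]) (use w in \<open>simp_all add: coroot_inject\<close>)
  then show ?thesis by blast
qed

lemma fundamental_weight_eqI:
  assumes "\<And>j. coroot D j w = (if j = i then 1 else 0)"
  shows "w = fundamental_weight D i"
  by (rule coroot_inject) (simp add: assms coroot_fundamental_weight)

lemma coxeter_word_fixed:
  assumes "distinct is" "set is = UNIV" "word_element D is v = v"
  shows "v = 0"
proof (rule nondegenerate)
  fix i
  obtain us ws where "is = us @ i # ws"
    using split_list_UNIV[OF assms(2)] by blast
  then have "v $ i = v $ i - coroot D i (\<chi> j. if j \<in> set ws then v $ j else v $ j)"
    by (intro word_element_distinct_nth[of us]) (use assms in simp_all)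
  then show "coroot D i v = 0" by simp
qed

text \<open>
  Comparing the formulas for the \<open>i\<close>-th coordinate of \<open>x = w v\<close> given by the two words leaves a
  linear relation among the coordinates of \<open>w v - v\<close>.  This vector is arbitrary, since \<open>1\<close> is
  not an eigenvalue of \<open>w\<close>; so both words order each pair of neighbours in the same way.
\<close>

lemma downhill_transfer:
  assumes "is": "distinct is" "set is = UNIV" "downhill D \<xi> is"
    and js: "distinct js" "set js = UNIV"
    and eq: "word_element D js = word_element D is"
  shows "downhill D \<xi> js"
  unfolding downhill_def sorted_wrt_iff_split
proof (intro allI impI ballI)
  fix us i ws j
  assume dec: "js = us @ i # ws" and j: "j \<in> set ws" and adj: "adjacent D i j"
  interpret c: linear "coroot D i" by (rule linear_coroot)
  obtain us' ws' where dec': "is = us' @ i # ws'"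
    using split_list_UNIV[OF "is"(2)] by blast
  have lin: "linear (\<lambda>v. word_element D is v - v)"
    by (rule linear_compose_sub[OF linear_word_element linear_ident])
  have "inj (\<lambda>v. word_element D is v - v)"
    unfolding linear_injective_0[OF lin]
  proof (intro allI impI)
    fix u assume "word_element D is u - u = 0"
    then show "u = 0" by (intro coxeter_word_fixed[OF "is"(1,2)]) simp
  qed
  with lin have "surj (\<lambda>v. word_element D is v - v)"
    by (rule linear_inj_imp_surj)
  \<comment> \<open>Only coordinate \<open>j\<close> changes, so the two mixed vectors can differ
    only by whether \<open>j\<close> stands behind \<open>i\<close> in each word.\<close>
  from surjD[OF this] obtain v where v: "simple_root j = word_element D is v - v" by blast
  define x where "x = word_element D is v"
  have x: "x = v + simple_root j" unfolding x_def v by simp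
  have mix: "(\<chi> k. if k \<in> A then x $ k else v $ k) =
      v + (if j \<in> A then 1 else 0) *\<^sub>R simple_root j" for A
    unfolding x by (auto simp: vec_eq_iff axis_def)
  have "x = word_element D (us @ i # ws) v" "x = word_element D (us' @ i # ws') v"
    using eq by (simp_all add: x_def flip: dec dec')
  from word_element_distinct_nth[OF js(1)[unfolded dec] this(1)]
    word_element_distinct_nth[OF "is"(1)[unfolded dec'] this(2)]
  have "coroot D i (\<chi> k. if k \<in> set ws then x $ k else v $ k) =
        coroot D i (\<chi> k. if k \<in> set ws' then x $ k else v $ k)"
    by linarith
  then have "j \<in> set ws'"
    using j cartan_adjacent[OF adj] unfolding mix
    by (simp add: c.add c.scale coroot_simple_root split: if_splits)
  then show "\<xi> j < \<xi> i"
    using "is"(3) adj unfolding dec' downhill_def by (auto simp: sorted_wrt_append)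
qed

text \<open>A reduced word for this product contains every letter, hence each exactly once, and
  inherits the downhill order. Conversely, any competitor has a downhill word and so solves the same
  system.\<close>

lemma quiver_coxeter_word:
  assumes Q: "dynkin_quiver D \<xi>" and "is": "distinct is" "set is = UNIV" "downhill D \<xi> is"
  shows "quiver_coxeter D \<xi> = word_element D is"
  unfolding quiver_coxeter_def
proof (rule the_equality)
  have len: "length js \<ge> CARD('v)" if "set js = UNIV" for js :: "'v list"
    using card_length[of js] that by simp
  have "adapted D \<xi> js" if "reduced_expression D js (word_element D is)" for js
  proof -
    have w: "word_element D js = word_element D is" and "length js \<le> length is"
      using that by (auto simp: reduced_expression_def)
    moreover have js: "set js = UNIV"
      using coxeter_word_support[OF "is"(1,2) w] .
    ultimately have "length js = card (set js)"
      using len[OF js] distinct_card[OF "is"(1)] "is"(2) by simp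
    then have "distinct js" by (intro card_distinct) simp
    then show ?thesis
      using downhill_transfer[OF "is" _ js w] adapted_iff_downhill[OF Q _ js] by simp
  qed
  then show "coxeter_element D (word_element D is) \<and>
      (\<forall>js. reduced_expression D js (word_element D is) \<longrightarrow> adapted D \<xi> js)"
    using "is" by (auto simp: coxeter_element_def)
next
  fix \<tau>
  assume *: "coxeter_element D \<tau> \<and> (\<forall>js. reduced_expression D js \<tau> \<longrightarrow> adapted D \<xi> js)"
  then obtain ks where ks: "distinct ks" "set ks = UNIV" and \<tau>: "\<tau> = word_element D ks"
    by (auto simp: coxeter_element_def)
  \<comment> \<open>Reducedness lets the adaptedness condition be applied to \<open>ks\<close>
    itself.\<close>
  have "reduced_expression D ks \<tau>"
    unfolding reduced_expression_def
  proof (intro conjI allI impI)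
    fix js assume "word_element D js = \<tau>"
    then have "set js = UNIV" using coxeter_word_support[OF ks] \<tau> by simp
    then show "length ks \<le> length js"
      using card_length[of js] distinct_card[OF ks(1)] ks(2) by simp
  qed (simp add: \<tau>)
  then have "downhill D \<xi> ks" using * adapted_iff_downhill[OF Q ks] by blast
  then show "\<tau> = word_element D is"
    unfolding \<tau>
    by (intro ext coxeter_system_unique[OF coxeter_system_word[OF Q ks]]
        coxeter_system_word[OF Q "is"])
qed

lemma quiver_coxeter:
  assumes "dynkin_quiver D \<xi>"
  shows bij_quiver_coxeter: "bij (quiver_coxeter D \<xi>)"
    and coxeter_system_quiver_coxeter: "coxeter_system D \<xi> v (quiver_coxeter D \<xi> v)"
proof -
  obtain "is" where "is": "distinct is" "set is = UNIV" "downhill D \<xi> is"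
    using downhill_word_exists[OF assms] .
  show "bij (quiver_coxeter D \<xi>)" "coxeter_system D \<xi> v (quiver_coxeter D \<xi> v)"
    using quiver_coxeter_word[OF assms "is"] coxeter_system_word[OF assms "is"]
    by (simp_all add: bij_word_element)
qed

end

section \<open>Folding\<close>

lemma fold_roots_nth: "fold_roots b v $ p = (\<Sum>i\<in>UNIV. if b i = p then v $ i else 0)"
  unfolding fold_roots_def by (auto simp: axis_def intro!: sum.cong)

lemma fold_roots_diff: "fold_roots b (v - w) = fold_roots b v - fold_roots b w"
  by (simp add: fold_roots_def algebra_simps sum_subtractf)

text \<open>Bijectivity carries the intertwining over to the inverses, which covers negative
  exponents.\<close>

lemma int_power_intertwine:
  assumes "bij f" "bij g" "\<And>v. h (f v) = g (h v)"
  shows "h (int_power f k v) = int_power g k (h v)"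
proof -
  have pow: "h ((f' ^^ n) v) = (g' ^^ n) (h v)" if "\<And>v. h (f' v) = g' (h v)" for f' g' n
    by (induction n) (simp_all add: that)
  have "h (inv f v) = inv g (h v)" for v
    using assms by (metis bij_inv_eq_iff)
  then show ?thesis
    using pow[of f g] pow[of "inv f" "inv g"] assms(3) by (simp add: int_power_def)
qed

locale diagram_folding =
  source: nondegenerate_diagram D + target: nondegenerate_diagram D'
  for D :: "'v::finite dynkin" and D' :: "'w::finite dynkin" +
  fixes b :: "'v \<Rightarrow> 'w"
  assumes cartan_fold: "(\<Sum>i\<in>UNIV. if b i = p then cartan D i j else 0) = cartan D' p (b j)"
begin

text \<open>Linear extension of \<open>cartan_fold\<close>: the pullback of a coroot along the
  folding is the sum of the coroots in its fibre.\<close>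

lemma coroot_fold_roots:
  "coroot D' p (fold_roots b v) = (\<Sum>i\<in>UNIV. if b i = p then coroot D i v else 0)"
proof -
  interpret c: linear "coroot D' p" by (rule linear_coroot)
  have "coroot D' p (fold_roots b v) = (\<Sum>j\<in>UNIV. v $ j * of_int (cartan D' p (b j)))"
    by (simp add: fold_roots_def c.sum c.scale coroot_simple_root)
  also have "\<dots> = (\<Sum>j\<in>UNIV. \<Sum>i\<in>UNIV. if b i = p then of_int (cartan D i j) * v $ j else 0)"
    by (auto simp flip: cartan_fold simp: sum_distrib_left intro!: sum.cong)
  also have "\<dots> = (\<Sum>i\<in>UNIV. \<Sum>j\<in>UNIV. if b i = p then of_int (cartan D i j) * v $ j else 0)"
    by (rule sum.swap)
  also have "\<dots> = (\<Sum>i\<in>UNIV. if b i = p then coroot D i v else 0)"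
    by (auto simp: coroot_def intro!: sum.cong)
  finally show ?thesis .
qed

lemma fold_fundamental_weight:
  "fold_roots b (fundamental_weight D i) = fundamental_weight D' (b i)"
proof (rule target.fundamental_weight_eqI)
  fix p
  have "coroot D' p (fold_roots b (fundamental_weight D i)) =
        (\<Sum>j\<in>UNIV. if j = i then (if b i = p then 1 else 0) else 0)"
    unfolding coroot_fold_roots source.coroot_fundamental_weight
    by (intro sum.cong) auto
  then show "coroot D' p (fold_roots b (fundamental_weight D i)) = (if p = b i then 1 else 0)"
    by auto
qed

text \<open>Heights are constant on fibres, so interpolation commutes with folding, and the equation
  at \<open>p\<close> is the sum of the equations over the fibre of \<open>p\<close>.\<close>

lemma coxeter_system_fold:
  assumes \<xi>: "\<And>i. \<xi>' (b i) = \<xi> i" and "coxeter_system D \<xi> v x"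
  shows "coxeter_system D' \<xi>' (fold_roots b v) (fold_roots b x)"
  unfolding coxeter_system_def
proof
  fix p
  let ?z = "interpolate \<xi> (\<xi>' p) x v"
  have "fold_roots b ?z $ q =
      interpolate \<xi>' (\<xi>' p) (fold_roots b x) (fold_roots b v) $ q" for q
    by (auto simp: fold_roots_nth interpolate_def simp flip: \<xi> intro!: sum.cong sum.neutral)
  then have "interpolate \<xi>' (\<xi>' p) (fold_roots b x) (fold_roots b v) = fold_roots b ?z"
    by (simp add: vec_eq_iff)
  then have "fold_roots b x $ p + fold_roots b v $ p +
      coroot D' p (interpolate \<xi>' (\<xi>' p) (fold_roots b x) (fold_roots b v)) =
      (\<Sum>i\<in>UNIV. if b i = p then x $ i + v $ i + coroot D i ?z else 0)"
    unfolding coroot_fold_roots fold_roots_nth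
    by (simp add: coroot_fold_roots flip: sum.distrib) (auto intro!: sum.cong)
  also have "\<dots> = 0"
    using assms unfolding coxeter_system_def by (intro sum.neutral) auto
  finally show "fold_roots b x $ p + fold_roots b v $ p +
      coroot D' p (interpolate \<xi>' (\<xi>' p) (fold_roots b x) (fold_roots b v)) = 0" .
qed

theorem fold_quiver:
  assumes Q: "dynkin_quiver D \<xi>" and Q': "dynkin_quiver D' \<xi>'" and \<xi>: "\<And>i. \<xi>' (b i) = \<xi> i"
  shows "fold_roots b (int_power (quiver_coxeter D \<xi>) k (quiver_gamma D \<xi> i)) =
         int_power (quiver_coxeter D' \<xi>') k (quiver_gamma D' \<xi>' (b i))"
proof -
  \<comment> \<open>Both sides solve the folded system for \<open>fold_roots b v\<close>.\<close>
  have tau: "fold_roots b (quiver_coxeter D \<xi> v) = quiver_coxeter D' \<xi>' (fold_roots b v)" for v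
    using coxeter_system_fold[of \<xi>' \<xi>, OF \<xi> source.coxeter_system_quiver_coxeter[OF Q]]
      target.coxeter_system_quiver_coxeter[OF Q'] by (rule coxeter_system_unique)
  then have "fold_roots b (quiver_gamma D \<xi> i) = quiver_gamma D' \<xi>' (b i)"
    by (simp add: quiver_gamma_def fold_roots_diff fold_fundamental_weight)
  then show ?thesis
    using int_power_intertwine[of _ _ "fold_roots b", OF source.bij_quiver_coxeter[OF Q]
        target.bij_quiver_coxeter[OF Q'] tau] by simp
qed

end

section \<open>The four diagrams\<close>

lemma UNIV_e6: "UNIV = {E1, E2, E3, E4, E5, E6}"
  using e6.exhaust by blast

lemma UNIV_f4: "UNIV = {F1, F2, F3, F4}"
  using f4.exhaust by blast

lemma UNIV_d4: "UNIV = {D1, D2, D3, D4}"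
  using d4.exhaust by blast

lemma UNIV_g2: "UNIV = {G1, G2}"
  using g2.exhaust by blast

lemmas cartan_simps = cartan_def adjacent_def doubleton_eq_iff

interpretation E6: nondegenerate_diagram dynkin_E6
proof
  fix v assume "coroot dynkin_E6 i v = 0" for i
  from this[of E1] this[of E2] this[of E3] this[of E4] this[of E5] this[of E6]
  have "v $ E1 = 0 \<and> v $ E2 = 0 \<and> v $ E3 = 0 \<and> v $ E4 = 0 \<and> v $ E5 = 0 \<and> v $ E6 = 0"
    by (simp add: coroot_def UNIV_e6 cartan_simps dynkin_E6_def)
  then show "v = 0" unfolding vec_eq_iff by (metis e6.exhaust zero_index)
qed (simp add: dynkin_E6_def)

interpretation F4: nondegenerate_diagram dynkin_F4
proof
  show "half_sqlen dynkin_F4 i > 0" for i by (cases i) (simp_all add: dynkin_F4_def)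
next
  fix v assume "coroot dynkin_F4 i v = 0" for i
  from this[of F1] this[of F2] this[of F3] this[of F4]
  have "v $ F1 = 0 \<and> v $ F2 = 0 \<and> v $ F3 = 0 \<and> v $ F4 = 0"
    by (simp add: coroot_def UNIV_f4 cartan_simps dynkin_F4_def)
  then show "v = 0" unfolding vec_eq_iff by (metis f4.exhaust zero_index)
qed

interpretation D4: nondegenerate_diagram dynkin_D4
proof
  fix v assume "coroot dynkin_D4 i v = 0" for i
  from this[of D1] this[of D2] this[of D3] this[of D4]
  have "v $ D1 = 0 \<and> v $ D2 = 0 \<and> v $ D3 = 0 \<and> v $ D4 = 0"
    by (simp add: coroot_def UNIV_d4 cartan_simps dynkin_D4_def)
  then show "v = 0" unfolding vec_eq_iff by (metis d4.exhaust zero_index)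
qed (simp add: dynkin_D4_def)

interpretation G2: nondegenerate_diagram dynkin_G2
proof
  show "half_sqlen dynkin_G2 i > 0" for i by (cases i) (simp_all add: dynkin_G2_def)
next
  fix v assume "coroot dynkin_G2 i v = 0" for i
  from this[of G1] this[of G2]
  have "v $ G1 = 0 \<and> v $ G2 = 0"
    by (simp add: coroot_def UNIV_g2 cartan_simps dynkin_G2_def)
  then show "v = 0" unfolding vec_eq_iff by (metis g2.exhaust zero_index)
qed

text \<open>The double bond arises because two neighbours of \<open>E4\<close>, namely
  \<open>E3\<close> and \<open>E5\<close>, lie over \<open>F3\<close> and contribute -1
  each.\<close>

interpretation E6_F4: diagram_folding dynkin_E6 dynkin_F4 bar_E6
proof
  show "(\<Sum>i\<in>UNIV. if bar_E6 i = p then cartan dynkin_E6 i j else 0) =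
      cartan dynkin_F4 p (bar_E6 j)" for p j
    by (cases p; cases j) (simp_all add: UNIV_e6 cartan_simps dynkin_E6_def dynkin_F4_def)
qed

text \<open>All three neighbours of \<open>D2\<close> lie over \<open>G1\<close>, which gives the
  entry -3 of the triple bond.\<close>

interpretation D4_G2: diagram_folding dynkin_D4 dynkin_G2 bar_D4
proof
  show "(\<Sum>i\<in>UNIV. if bar_D4 i = p then cartan dynkin_D4 i j else 0) =
      cartan dynkin_G2 p (bar_D4 j)" for p j
    by (cases p; cases j) (simp_all add: UNIV_d4 cartan_simps dynkin_D4_def dynkin_G2_def)
qed

theorem theorem5p18:
  shows
    "(\<forall>(\<xi> :: e6 \<Rightarrow> int) (\<xi>' :: f4 \<Rightarrow> int).
        dynkin_quiver dynkin_E6 \<xi> \<and> fixed_by vee_E6 \<xi> \<and>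
        dynkin_quiver dynkin_F4 \<xi>' \<and> (\<forall>i. \<xi>' (bar_E6 i) = \<xi> i) \<longrightarrow>
        (\<forall>(k :: int) (i :: e6).
           fold_roots bar_E6
             (int_power (quiver_coxeter dynkin_E6 \<xi>) k (quiver_gamma dynkin_E6 \<xi> i)) =
           int_power (quiver_coxeter dynkin_F4 \<xi>') k (quiver_gamma dynkin_F4 \<xi>' (bar_E6 i)))) \<and>
     (\<forall>(\<xi> :: d4 \<Rightarrow> int) (\<xi>' :: g2 \<Rightarrow> int).
        dynkin_quiver dynkin_D4 \<xi> \<and> fixed_by vee_D4 \<xi> \<and>
        dynkin_quiver dynkin_G2 \<xi>' \<and> (\<forall>i. \<xi>' (bar_D4 i) = \<xi> i) \<longrightarrow>
        (\<forall>(k :: int) (i :: d4).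
           fold_roots bar_D4
             (int_power (quiver_coxeter dynkin_D4 \<xi>) k (quiver_gamma dynkin_D4 \<xi> i)) =
           int_power (quiver_coxeter dynkin_G2 \<xi>') k (quiver_gamma dynkin_G2 \<xi>' (bar_D4 i))))"
  using E6_F4.fold_quiver D4_G2.fold_quiver by blast

end
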